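(* Let $\mathcal X\subset\mathbb R^n$ be compact. Let $g$ and $h_1,\dots,h_k$ be real-valued $C^\infty$ (in particular twice continuously differentiable) functions of $(x,y)\in\mathcal X\times\mathbb R^m$ and let $\mathcal Y(x)=\{y\in\mathbb R^m:h_i(x,y)\le0,\ i=1,\dots,k\}$. Assume that $\mathcal Y(x)\neq\emptyset$ for every $x\in\mathcal X$, that the sets $\mathcal Y(x)$, $x\in\mathcal X$, are uniformly bounded, and that LICQ, SCSC and uniform SOSC hold for the lower-level problem $\min_{y\in\mathcal Y(x)}g(x,y)$ at every $x\in\mathcal X$. Then there exist uniform constants $c>0$ and $\delta>0$ such that for any $x\in\mathcal X$ and any local minimizer $y^\ast(x)$ of the lower-level problem at $x$, $$g(x,y)\ge g(x,y^\ast(x))+c\|y-y^\ast(x)\|^2\qquad\text{for all }y\in\mathcal Y(x)\cap B_\delta(y^\ast(x)),$$ where $B_\delta(y^\ast(x))$ is the ball of radius $\delta$ centered at $y^\ast(x)$.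
   Context: Active set: $\mathcal J(x,y)=\{i:h_i(x,y)=0\}$. KKT pair at $x$: $(y,\lambda)\in\mathbb R^m\times\mathbb R^k$ with $\nabla_y g(x,y)+\sum_i\lambda_i\nabla_y h_i(x,y)=0$, $h_i(x,y)\le 0$, $\lambda_i\ge 0$, $\lambda_i h_i(x,y)=0$ for all $i$. Lagrangian: $\mathcal L(x,y,\lambda)=g(x,y)+\sum_{i}\lambda_i h_i(x,y)$. LICQ holds at $x$ if for every $y\in\mathcal Y(x)$ the vectors $\{\nabla_y h_i(x,y): i\in\mathcal J(x,y)\}$ are linearly independent. SCSC holds at $x$ if for every KKT pair $(y^\ast,\lambda^\ast)$ at $x$ and every $i$, either $h_i(x,y^\ast)<0$ and $\lambda^\ast_i=0$, or $h_i(x,y^\ast)=0$ and $\lambda^\ast_i>0$. Critical cone at a KKT pair $(y^\ast,\lambda^\ast)$: $\mathcal C(x,y^\ast)=\{d\in\mathbb R^m:\nabla_y h_i(x,y^\ast)^\top d=0\text{ if }\lambda^\ast_i>0,\ \nabla_y h_i(x,y^\ast)^\top d\le 0\text{ if }\lambda^\ast_i=0,\ \forall i\in\mathcal J(x,y^\ast)\}$. Uniform SOSC: there is $\sigma>0$, independent of $x$, such that for every $x\in\mathcal X$ and every local minimizer $y^\ast$ at $x$ with associated KKT multiplier $\lambda^\ast$, $d^\top\nabla^2_{yy}\mathcal L(x,y^\ast,\lambda^\ast)d\ge\sigma\|d\|^2$ for all $d\in\mathcal C(x,y^\ast)$. Uniformly bounded: there is $R>0$ with $\mathcal Y(x)\subset\{y:\|y\|\le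 R\}$ for all $x\in\mathcal X$. *)

theory Defs
  imports "HOL-Analysis.Analysis"
begin

text \<open>Smoothness on an open set \<open>U\<close>: differentiable \<open>k\<close> times, every derivative of order
  \<open>< k\<close> being differentiable in the sense of \<open>has_derivative\<close>, and those of order \<open>k\<close> continuous.\<close>

primrec Ck_on :: "nat \<Rightarrow> 'a::euclidean_space set \<Rightarrow> ('a \<Rightarrow> real) \<Rightarrow> bool" where
  "Ck_on 0 U f \<longleftrightarrow> continuous_on U f"
| "Ck_on (Suc k) U f \<longleftrightarrow>
     (\<forall>z\<in>U. f differentiable (at z)) \<and>
     (\<forall>v. Ck_on k U (\<lambda>z. frechet_derivative f (at z) v))"

text \<open>On a set \<open>S\<close> that need not be open (here \<open>S = X \<times> \<real>\<^sup>m\<close> with \<open>X\<close> compact), a function is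
  smooth if it is the restriction of a smooth function on some open neighbourhood of \<open>S\<close>.\<close>

definition smooth_on :: "'a::euclidean_space set \<Rightarrow> ('a \<Rightarrow> real) \<Rightarrow> bool" where
  "smooth_on S f \<longleftrightarrow>
     (\<exists>U F. open U \<and> S \<subseteq> U \<and> (\<forall>k. Ck_on k U F) \<and> (\<forall>z\<in>S. F z = f z))"

definition grad :: "(real ^ 'm \<Rightarrow> real) \<Rightarrow> real ^ 'm \<Rightarrow> real ^ 'm" where
  "grad f y = (\<chi> j. frechet_derivative f (at y) (axis j 1))"

definition hessian :: "(real ^ 'm \<Rightarrow> real) \<Rightarrow> real ^ 'm \<Rightarrow> real ^ 'm ^ 'm" where
  "hessian f y = jacobian (grad f) (at y)"

text \<open>In what follows, \<open>x\<close> is the upper-level and \<open>y\<close> the lower-level variable, \<open>g x y\<close> is the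
  objective, and \<open>h i x y\<close> for \<open>i :: 'k\<close> are the constraints. Gradients and Hessians are taken
  in \<open>y\<close>, of the sections \<open>g x\<close> and \<open>h i x\<close>, which are defined on all of \<open>\<real>\<^sup>m\<close>.\<close>

definition feasible_set :: "('k \<Rightarrow> real ^ 'n \<Rightarrow> real ^ 'm \<Rightarrow> real) \<Rightarrow> real ^ 'n \<Rightarrow> (real ^ 'm) set" where
  "feasible_set h x = {y. \<forall>i. h i x y \<le> 0}"

definition active_set :: "('k \<Rightarrow> real ^ 'n \<Rightarrow> real ^ 'm \<Rightarrow> real) \<Rightarrow> real ^ 'n \<Rightarrow> real ^ 'm \<Rightarrow> 'k set" where
  "active_set h x y = {i. h i x y = 0}"

definition lagrangian ::
  "(real ^ 'n \<Rightarrow> real ^ 'm \<Rightarrow> real) \<Rightarrow> ('k::finite \<Rightarrow> real ^ 'n \<Rightarrow> real ^ 'm \<Rightarrow> real) \<Rightarrow>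
   real ^ 'n \<Rightarrow> real ^ 'm \<Rightarrow> real ^ 'k \<Rightarrow> real" where
  "lagrangian g h x y lam = g x y + (\<Sum>i\<in>UNIV. lam $ i * h i x y)"

definition KKT_pair ::
  "(real ^ 'n \<Rightarrow> real ^ 'm \<Rightarrow> real) \<Rightarrow> ('k::finite \<Rightarrow> real ^ 'n \<Rightarrow> real ^ 'm \<Rightarrow> real) \<Rightarrow>
   real ^ 'n \<Rightarrow> real ^ 'm \<Rightarrow> real ^ 'k \<Rightarrow> bool" where
  "KKT_pair g h x y lam \<longleftrightarrow>
     grad (g x) y + (\<Sum>i\<in>UNIV. lam $ i *\<^sub>R grad (h i x) y) = 0 \<and>
     (\<forall>i. h i x y \<le> 0 \<and> lam $ i \<ge> 0 \<and> lam $ i * h i x y = 0)"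

definition local_minimizer ::
  "(real ^ 'n \<Rightarrow> real ^ 'm \<Rightarrow> real) \<Rightarrow> ('k \<Rightarrow> real ^ 'n \<Rightarrow> real ^ 'm \<Rightarrow> real) \<Rightarrow>
   real ^ 'n \<Rightarrow> real ^ 'm \<Rightarrow> bool" where
  "local_minimizer g h x y \<longleftrightarrow>
     y \<in> feasible_set h x \<and>
     (\<exists>\<epsilon>>0. \<forall>z \<in> feasible_set h x \<inter> ball y \<epsilon>. g x y \<le> g x z)"

text \<open>Linear independence of the active gradients is that of an indexed family: two distinct active
  constraints with the same gradient violate it. Hence \<open>inj_on\<close> is required alongside
  \<^const>\<open>independent\<close>, which only sees the set of vectors.\<close>

definition LICQ :: "('k \<Rightarrow> real ^ 'n \<Rightarrow> real ^ 'm \<Rightarrow> real) \<Rightarrow> real ^ 'n \<Rightarrow> bool" where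
  "LICQ h x \<longleftrightarrow>
     (\<forall>y \<in> feasible_set h x.
        inj_on (\<lambda>i. grad (h i x) y) (active_set h x y) \<and>
        independent ((\<lambda>i. grad (h i x) y) ` active_set h x y))"

definition SCSC ::
  "(real ^ 'n \<Rightarrow> real ^ 'm \<Rightarrow> real) \<Rightarrow> ('k::finite \<Rightarrow> real ^ 'n \<Rightarrow> real ^ 'm \<Rightarrow> real) \<Rightarrow>
   real ^ 'n \<Rightarrow> bool" where
  "SCSC g h x \<longleftrightarrow>
     (\<forall>y lam. KKT_pair g h x y lam \<longrightarrow>
        (\<forall>i. h i x y < 0 \<and> lam $ i = 0 \<or> h i x y = 0 \<and> lam $ i > 0))"

definition critical_cone ::
  "('k::finite \<Rightarrow> real ^ 'n \<Rightarrow> real ^ 'm \<Rightarrow> real) \<Rightarrow> real ^ 'n \<Rightarrow> real ^ 'm \<Rightarrow> real ^ 'k \<Rightarrow>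
   (real ^ 'm) set" where
  "critical_cone h x y lam =
     {d. \<forall>i \<in> active_set h x y.
           (lam $ i > 0 \<longrightarrow> grad (h i x) y \<bullet> d = 0) \<and>
           (lam $ i = 0 \<longrightarrow> grad (h i x) y \<bullet> d \<le> 0)}"

definition uniform_SOSC ::
  "(real ^ 'n \<Rightarrow> real ^ 'm \<Rightarrow> real) \<Rightarrow> ('k::finite \<Rightarrow> real ^ 'n \<Rightarrow> real ^ 'm \<Rightarrow> real) \<Rightarrow>
   (real ^ 'n) set \<Rightarrow> bool" where
  "uniform_SOSC g h X \<longleftrightarrow>
     (\<exists>\<sigma>>0. \<forall>x\<in>X. \<forall>y lam. local_minimizer g h x y \<and> KKT_pair g h x y lam \<longrightarrow>
        (\<forall>d \<in> critical_cone h x y lam.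
           d \<bullet> (hessian (\<lambda>z. lagrangian g h x z lam) y *v d) \<ge> \<sigma> * (norm d)\<^sup>2))"

definition uniformly_bounded ::
  "('k \<Rightarrow> real ^ 'n \<Rightarrow> real ^ 'm \<Rightarrow> real) \<Rightarrow> (real ^ 'n) set \<Rightarrow> bool" where
  "uniformly_bounded h X \<longleftrightarrow> (\<exists>R>0. \<forall>x\<in>X. feasible_set h x \<subseteq> {y. norm y \<le> R})"

end

theory Submission
  imports Defs
begin

text \<open>
  Suppose growth fails along \<open>x\<^sub>n\<close>, local minimizers \<open>p\<^sub>n\<close> and feasible \<open>y\<^sub>n\<close> with
  \<open>y\<^sub>n - p\<^sub>n \<rightarrow> 0\<close>. By compactness \<open>x\<^sub>n \<rightarrow> x\<close>, \<open>p\<^sub>n \<rightarrow> p\<close>, and the directions from \<open>p\<^sub>n\<close> to \<open>y\<^sub>n\<close> tend to a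
  unit vector \<open>d\<close>. LICQ at \<open>x\<close> makes the multipliers of \<open>p\<^sub>n\<close> converge to one of \<open>p\<close>, which by SCSC
  is positive on the active set. Expanding the Lagrangian at \<open>p\<^sub>n\<close> to second order then gives both
  \<open>\<nabla>h\<^sub>i \<bullet> d = 0\<close> for \<open>i\<close> active at \<open>p\<close> and \<open>d \<bullet> \<nabla>\<^sup>2L d \<le> 0\<close>. The limit \<open>p\<close> need not be a local minimizer,
  so SOSC is applied at \<open>p\<^sub>n\<close>, to tangent vectors \<open>e\<^sub>n \<rightarrow> d\<close> provided by LICQ; in the limit
  \<open>d \<bullet> \<nabla>\<^sup>2L d \<ge> \<sigma> > 0\<close>, a contradiction.
\<close>

subsection \<open>Sections of smooth functions\<close>

lemma section_has_derivative:
  fixes F :: "'a::real_normed_vector \<times> 'b::real_normed_vector \<Rightarrow> real"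
  assumes "F differentiable (at (x, y))"
  shows "((\<lambda>y. F (x, y)) has_derivative (\<lambda>v. frechet_derivative F (at (x, y)) (0, v))) (at y)"
proof -
  have "((\<lambda>y. (x, y)) has_derivative (\<lambda>v. (0, v))) (at y)"
    by (auto intro!: derivative_eq_intros)
  from has_derivative_compose[OF this assms[unfolded frechet_derivative_works]]
  show ?thesis .
qed

text \<open>For \<open>x\<close> in \<open>X\<close> the section \<open>f x\<close> equals
  \<open>F (x, _)\<close> on the whole space, \<open>F\<close> being a smooth extension. Derivatives
  in \<open>y\<close> are therefore derivatives of \<open>F\<close> in directions
  \<open>(0, v)\<close>, and their joint continuity in \<open>(x, y)\<close>, needed for limits
  along varying \<open>x\<close>, is inherited from \<open>U\<close>.\<close>

lemma smooth_on_sections: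
  fixes f :: "real ^ 'n \<Rightarrow> real ^ 'm \<Rightarrow> real"
  assumes "smooth_on (X \<times> UNIV) (\<lambda>(x, y). f x y)"
  shows smooth_on_grad: "x \<in> X \<Longrightarrow> (f x has_derivative (\<lambda>v. grad (f x) y \<bullet> v)) (at y)"
    and smooth_on_hessian:
      "x \<in> X \<Longrightarrow> (grad (f x) has_derivative (\<lambda>v. hessian (f x) y *v v)) (at y)"
    and smooth_on_continuous: "continuous_on (X \<times> UNIV) (\<lambda>(x, y). f x y)"
    and smooth_on_continuous_grad: "continuous_on (X \<times> UNIV) (\<lambda>(x, y). grad (f x) y)"
    and smooth_on_continuous_hessian: "continuous_on (X \<times> UNIV) (\<lambda>(x, y). hessian (f x) y)"
proof -
  obtain U F where U: "X \<times> UNIV \<subseteq> U" and C: "\<And>k. Ck_on k U F"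
    and F: "\<And>z. z \<in> X \<times> UNIV \<Longrightarrow> F z = (case z of (x, y) \<Rightarrow> f x y)"
    using assms unfolding smooth_on_def by blast
  define D where "D i z = frechet_derivative F (at z) (0, axis i 1)" for i z
  define E where "E i j z = frechet_derivative (D i) (at z) (0, axis j 1)" for i j z
  have dF: "F differentiable at z" if "z \<in> U" for z
    using C[of "Suc 0"] that by auto
  have dD: "D i differentiable at z" if "z \<in> U" for z i
    using C[of "Suc (Suc 0)"] that unfolding D_def by auto
  have cF: "continuous_on U F" using C[of 0] by simp
  have cD: "continuous_on U (D i)" for i
    using C[of "Suc 0"] unfolding D_def by auto
  have cE: "continuous_on U (E i j)" for i j
    using C[of "Suc (Suc 0)"] unfolding E_def D_def by auto
  have fx: "f x = (\<lambda>y. F (x, y))" if "x \<in> X" for x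
    using F that by auto
  have df: "(f x has_derivative (\<lambda>v. frechet_derivative F (at (x, y)) (0, v))) (at y)"
    if "x \<in> X" for x y
    unfolding fx[OF that] using that U by (intro section_has_derivative dF) auto
  have gr: "grad (f x) y = (\<chi> j. D j (x, y))" if "x \<in> X" for x y
    unfolding grad_def D_def frechet_derivative_at[OF df[OF that], symmetric] by simp
  show 1: "(f x has_derivative (\<lambda>v. grad (f x) y \<bullet> v)) (at y)" if "x \<in> X" for x y
  proof -
    have lin: "linear (frechet_derivative (f x) (at y))"
      using df[OF that] by (metis differentiableI linear_frechet_derivative)
    have "frechet_derivative (f x) (at y) v = grad (f x) y \<bullet> v" for v
    proof -
      have "frechet_derivative (f x) (at y) v = frechet_derivative (f x) (at y) (\<Sum>j\<in>UNIV. v $ j *\<^sub>R axis j 1)"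
        by (simp add: basis_expansion flip: scalar_mult_eq_scaleR)
      also have "\<dots> = grad (f x) y \<bullet> v"
        by (simp add: linear_sum[OF lin] linear_scale[OF lin] grad_def inner_vec_def mult.commute)
      finally show ?thesis .
    qed
    then show ?thesis
      using df[OF that] by (metis (no_types, lifting) ext differentiableI frechet_derivative_works)
  qed
  have dg: "(grad (f x) has_derivative (\<lambda>v. \<chi> i. frechet_derivative (D i) (at (x, y)) (0, v))) (at y)"
    if "x \<in> X" for x y
  proof -
    have "((\<lambda>y. \<chi> i. D i (x, y)) has_derivative (\<lambda>v. \<chi> i. frechet_derivative (D i) (at (x, y)) (0, v))) (at y)"
    proof (rule has_derivative_componentwise_within[THEN iffD2], rule ballI)
      fix b :: "real ^ 'm" assume "b \<in> Basis"
      then obtain i where b: "b = axis i 1" by (auto simp: Basis_vec_def)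
      show "((\<lambda>y. (\<chi> i. D i (x, y)) \<bullet> b) has_derivative
          (\<lambda>v. (\<chi> i. frechet_derivative (D i) (at (x, y)) (0, v)) \<bullet> b)) (at y)"
        unfolding b inner_axis using that U
        by (auto intro!: section_has_derivative dD)
    qed
    moreover have "grad (f x) = (\<lambda>y. \<chi> i. D i (x, y))"
      using gr[OF that] by (intro ext)
    ultimately show ?thesis by metis
  qed
  show "(grad (f x) has_derivative (\<lambda>v. hessian (f x) y *v v)) (at y)" if "x \<in> X" for x y
    using dg[OF that] jacobian_works unfolding hessian_def by (metis differentiableI)
  have he: "hessian (f x) y = (\<chi> i j. E i j (x, y))" if "x \<in> X" for x y
    unfolding hessian_def jacobian_def matrix_def E_def
      frechet_derivative_at[OF dg[OF that], symmetric] by simp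
  show "continuous_on (X \<times> UNIV) (\<lambda>(x, y). f x y)"
    using continuous_on_subset[OF cF U] F by (metis (no_types, lifting) continuous_on_cong)
  have "continuous_on (X \<times> UNIV) (\<lambda>z. \<chi> j. D j z)"
    using continuous_on_subset[OF cD U] by (intro continuous_intros)
  then show "continuous_on (X \<times> UNIV) (\<lambda>(x, y). grad (f x) y)"
    by (rule continuous_on_eq) (auto simp: gr)
  have "continuous_on (X \<times> UNIV) (\<lambda>z. \<chi> i j. E i j z)"
    using continuous_on_subset[OF cE U] by (intro continuous_intros)
  then show "continuous_on (X \<times> UNIV) (\<lambda>(x, y). hessian (f x) y)"
    by (rule continuous_on_eq) (auto simp: he)
qed

text \<open>The one-variable mean value theorem on the segment from \<open>y\<close> to
  \<open>w\<close>. Of the intermediate point only the distance bound is kept: it suffices to make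
  such points converge when both ends do.\<close>

lemma segment_mean_value:
  fixes f :: "'a::real_inner \<Rightarrow> real"
  assumes "\<And>z. (f has_derivative (\<lambda>v. f' z \<bullet> v)) (at z)"
  shows "\<exists>z. dist z y \<le> dist w y \<and> f w = f y + f' z \<bullet> (w - y)"
proof -
  define p where "p t = y + t *\<^sub>R (w - y)" for t
  have "((\<lambda>t. f (p t)) has_real_derivative f' (p t) \<bullet> (w - y)) (at t)" for t
  proof -
    have "(p has_derivative (\<lambda>s. s *\<^sub>R (w - y))) (at t)"
      unfolding p_def by (auto intro!: derivative_eq_intros)
    from has_derivative_compose[OF this assms] show ?thesis
      unfolding has_field_derivative_def by (rule has_derivative_eq_rhs) (simp add: fun_eq_iff)
  qed
  from MVT2[OF zero_less_one this]
  obtain t where t: "0 < t" "t < 1" "f (p 1) - f (p 0) = f' (p t) \<bullet> (w - y)" by force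
  have "dist (p t) y \<le> dist w y"
    using t by (simp add: p_def dist_norm mult_left_le_one_le)
  then show ?thesis using t by (intro exI[of _ "p t"]) (auto simp: p_def)
qed

lemma segment_taylor2:
  fixes f :: "real ^ 'm \<Rightarrow> real"
  assumes f: "\<And>z. (f has_derivative (\<lambda>v. f' z \<bullet> v)) (at z)"
    and f': "\<And>z. (f' has_derivative (\<lambda>v. H z *v v)) (at z)"
  shows "\<exists>z. dist z y \<le> dist w y \<and>
    f w = f y + f' y \<bullet> (w - y) + (w - y) \<bullet> (H z *v (w - y)) / 2"
proof -
  define p where "p t = y + t *\<^sub>R (w - y)" for t
  \<comment> \<open>\<open>\<phi> m\<close> is the \<open>m\<close>-th derivative of
    \<open>f\<close> along the segment for \<open>m\<close> up to 2, the orders that a second-order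
    Maclaurin expansion uses.\<close>
  define \<phi> where "\<phi> m t = (if m = 0 then f (p t) else if m = 1 then f' (p t) \<bullet> (w - y)
    else (H (p t) *v (w - y)) \<bullet> (w - y))" for m :: nat and t
  have p: "(p has_derivative (\<lambda>s. s *\<^sub>R (w - y))) (at t)" for t
    unfolding p_def by (auto intro!: derivative_eq_intros)
  have d0: "((\<lambda>t. f (p t)) has_real_derivative f' (p t) \<bullet> (w - y)) (at t)" for t
    using has_derivative_compose[OF p f] unfolding has_field_derivative_def
    by (rule has_derivative_eq_rhs) (simp add: fun_eq_iff)
  have d1: "((\<lambda>t. f' (p t) \<bullet> (w - y)) has_real_derivative (H (p t) *v (w - y)) \<bullet> (w - y)) (at t)" for t
    using has_derivative_inner_left[OF has_derivative_compose[OF p f'], of "w - y"]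
    unfolding has_field_derivative_def
    by (rule has_derivative_eq_rhs) (simp add: fun_eq_iff matrix_vector_mult_scaleR)
  have "\<forall>m t. m < 2 \<and> 0 \<le> t \<and> t \<le> 1 \<longrightarrow> (\<phi> m has_real_derivative \<phi> (Suc m) t) (at t)"
    using d0 d1 by (auto simp: \<phi>_def[abs_def] less_2_cases_iff)
  moreover have "\<phi> 0 = (\<lambda>t. f (p t))" by (simp add: \<phi>_def[abs_def])
  ultimately have "\<exists>t. 0 < t \<and> t < 1 \<and>
      f (p 1) = (\<Sum>m<2. \<phi> m 0 / fact m * 1 ^ m) + \<phi> 2 t / fact 2 * 1\<^sup>2"
    using Maclaurin[of 1 2 \<phi> "\<lambda>t. f (p t)"] by simp
  then
  obtain t where t: "0 < t" "t < 1"
    "f (p 1) = (\<Sum>m<2. \<phi> m 0 / fact m * 1 ^ m) + \<phi> 2 t / fact 2 * 1\<^sup>2"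
    by blast
  have "dist (p t) y \<le> dist w y"
    using t by (simp add: p_def dist_norm mult_left_le_one_le)
  then show ?thesis using t
    by (intro exI[of _ "p t"]) (auto simp: p_def \<phi>_def lessThan_Suc eval_nat_numeral inner_commute)
qed

subsection \<open>Perturbation of linearly independent families\<close>

text \<open>Coefficients are vectors indexed by all of \<open>'k\<close>, and active sets enter only
  through \<open>supp_on\<close>. Multipliers belonging to different active sets thus live in one
  Euclidean space, where they can converge.\<close>

definition lin_comb :: "('k::finite \<Rightarrow> 'a::euclidean_space) \<Rightarrow> real ^ 'k \<Rightarrow> 'a" where
  "lin_comb a u = (\<Sum>i\<in>UNIV. u $ i *\<^sub>R a i)"

definition supp_on :: "'k set \<Rightarrow> (real ^ 'k::finite) set" where
  "supp_on J = {u. \<forall>i. i \<notin> J \<longrightarrow> u $ i = 0}"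

definition lin_indep :: "('k \<Rightarrow> 'a::euclidean_space) \<Rightarrow> 'k set \<Rightarrow> bool" where
  "lin_indep a J \<longleftrightarrow> inj_on a J \<and> independent (a ` J)"

lemma linear_lin_comb: "linear (lin_comb a)"
  unfolding lin_comb_def
  by (rule linearI) (simp_all add: scaleR_left_distrib sum.distrib scaleR_sum_right)

lemma subspace_supp_on: "subspace (supp_on J)"
  by (auto simp: subspace_def supp_on_def)

lemma lin_comb_eq_0D:
  assumes "lin_indep a J" "u \<in> supp_on J" "lin_comb a u = 0"
  shows "u = 0"
proof -
  have J: "inj_on a J" "independent (a ` J)" using assms by (auto simp: lin_indep_def)
  define w where "w v = u $ the_inv_into J a v" for v
  have w: "w (a i) = u $ i" if "i \<in> J" for i
    using J that by (simp add: w_def the_inv_into_f_f)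
  have "lin_comb a u = (\<Sum>i\<in>J. u $ i *\<^sub>R a i)"
    unfolding lin_comb_def using assms(2)
    by (intro sum.mono_neutral_right) (auto simp: supp_on_def)
  also have "\<dots> = (\<Sum>v\<in>a ` J. w v *\<^sub>R v)"
    using J w by (simp add: sum.reindex)
  finally have "(\<Sum>v\<in>a ` J. w v *\<^sub>R v) = 0" using assms by simp
  then have "w v = 0" if "v \<in> a ` J" for v
    using J(2) that independentD[of "a ` J" "a ` J" w v] by simp
  then have "u $ i = 0" for i
    using w assms(2) by (cases "i \<in> J") (auto simp: supp_on_def)
  then show ?thesis by (simp add: vec_eq_iff)
qed

text \<open>Independence makes \<open>lin_comb a\<close> injective on the finite-dimensional
  subspace \<open>supp_on J\<close>, and an injective linear map there is bounded below.\<close>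

lemma lin_comb_lower_bound:
  assumes "lin_indep a J"
  obtains c where "c > 0" "\<And>u. u \<in> supp_on J \<Longrightarrow> c * norm u \<le> norm (lin_comb a u)"
  using injective_imp_isometric[of "supp_on J" "lin_comb a"] lin_comb_eq_0D[OF assms]
  by (metis closed_subspace linear_lin_comb linear_conv_bounded_linear subspace_supp_on)

lemma norm_lin_comb_diff_le:
  "norm (lin_comb a u - lin_comb b u) \<le> (\<Sum>i\<in>UNIV. norm (a i - b i)) * norm u"
proof -
  have "norm (lin_comb a u - lin_comb b u) = norm (\<Sum>i\<in>UNIV. u $ i *\<^sub>R (a i - b i))"
    by (simp add: lin_comb_def sum_subtractf scaleR_diff_right)
  also have "\<dots> \<le> (\<Sum>i\<in>UNIV. norm (a i - b i) * norm u)"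
    by (intro sum_norm_le) (simp add: mult.commute[of "norm (_ - _)"] component_le_norm_cart mult_right_mono)
  finally show ?thesis by (simp add: sum_distrib_right)
qed

text \<open>Replacing \<open>a\<close> by \<open>b n\<close> moves the combination by at most the
  sum of the \<open>norm (a i - b n i)\<close> times \<open>norm u\<close>. Once that sum is below
  \<open>c / 2\<close>, half of the lower bound for \<open>a\<close> survives, uniformly in
  \<open>u\<close>.\<close>

lemma lin_comb_lower_bound_eventually:
  assumes "lin_indep a J" and lim: "\<And>i. ((\<lambda>n. b n i) \<longlongrightarrow> a i) F"
  obtains c where "c > 0"
    "\<forall>\<^sub>F n in F. \<forall>u \<in> supp_on J. c * norm u \<le> norm (lin_comb (b n) u)"
proof -
  obtain c where c: "c > 0" "\<And>u. u \<in> supp_on J \<Longrightarrow> c * norm u \<le> norm (lin_comb a u)"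
    using lin_comb_lower_bound[OF assms(1)] by blast
  have "((\<lambda>n. \<Sum>i\<in>UNIV. norm (a i - b n i)) \<longlongrightarrow> (\<Sum>i\<in>UNIV. norm (a i - a i))) F"
    by (intro tendsto_intros lim)
  then have "\<forall>\<^sub>F n in F. (\<Sum>i\<in>UNIV. norm (a i - b n i)) < c / 2"
    using c(1) by (intro order_tendstoD) auto
  then have "\<forall>\<^sub>F n in F. \<forall>u \<in> supp_on J. c / 2 * norm u \<le> norm (lin_comb (b n) u)"
  proof eventually_elim
    case (elim n)
    show ?case
    proof
      fix u assume "u \<in> supp_on J"
      then have "c * norm u \<le> norm (lin_comb a u)" by (rule c)
      moreover have "norm (lin_comb a u - lin_comb (b n) u) \<le> c / 2 * norm u"
        using norm_lin_comb_diff_le[of a u "b n"] elim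
        by (meson less_imp_le mult_right_mono norm_ge_zero order_trans)
      ultimately show "c / 2 * norm u \<le> norm (lin_comb (b n) u)"
        using norm_triangle_ineq2[of "lin_comb a u" "lin_comb (b n) u"] by (simp add: field_simps)
    qed
  qed
  with c(1) show ?thesis by (intro that[of "c / 2"]) auto
qed

text \<open>The uniform lower bound for \<open>b n\<close> bounds the coefficients. Hence
  \<open>lin_comb a (u n)\<close> differs from \<open>lin_comb (b n) (u n)\<close> by a null
  sequence and also tends to \<open>s\<close>; the lower bound for the fixed family \<open>a\<close>
  then makes \<open>u\<close> Cauchy. The whole sequence converges, without passing to a
  subsequence.\<close>

lemma coefficients_converge:
  fixes u :: "nat \<Rightarrow> real ^ 'k::finite"
  assumes ind: "lin_indep a J" and lim: "\<And>i. (\<lambda>n. b n i) \<longlonglongrightarrow> a i"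
    and supp: "\<forall>\<^sub>F n in sequentially. u n \<in> supp_on J"
    and s: "(\<lambda>n. lin_comb (b n) (u n)) \<longlonglongrightarrow> s"
  obtains l where "u \<longlonglongrightarrow> l" "lin_comb a l = s"
proof -
  obtain c where c: "c > 0"
    "\<forall>\<^sub>F n in sequentially. \<forall>u \<in> supp_on J. c * norm u \<le> norm (lin_comb (b n) u)"
    using lin_comb_lower_bound_eventually[OF ind lim] by blast
  obtain B where B: "\<And>n. norm (lin_comb (b n) (u n)) \<le> B"
    using convergent_imp_Bseq[OF convergentI[OF s]] by (auto simp: Bseq_def)
  have "\<forall>\<^sub>F n in sequentially. norm (u n) \<le> B / c"
    using c(2) supp
  proof eventually_elim
    case (elim n)
    then have "c * norm (u n) \<le> B" using B[of n] by (meson order_trans)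
    with c(1) show ?case by (simp add: field_simps)
  qed
  then have "\<forall>\<^sub>F n in sequentially. norm (lin_comb a (u n) - lin_comb (b n) (u n))
      \<le> (\<Sum>i\<in>UNIV. norm (a i - b n i)) * (B / c)"
    by eventually_elim
      (rule order_trans[OF norm_lin_comb_diff_le], rule mult_left_mono, auto intro: sum_nonneg)
  moreover have "(\<lambda>n. (\<Sum>i\<in>UNIV. norm (a i - b n i)) * (B / c))
      \<longlonglongrightarrow> (\<Sum>i\<in>UNIV. norm (a i - a i)) * (B / c)"
    by (intro tendsto_intros lim)
  ultimately have "(\<lambda>n. lin_comb a (u n) - lin_comb (b n) (u n)) \<longlonglongrightarrow> 0"
    by (simp add: Lim_null_comparison)
  from tendsto_add[OF this s] have t: "(\<lambda>n. lin_comb a (u n)) \<longlonglongrightarrow> s" by simp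
  obtain e where e: "e > 0" "\<And>u. u \<in> supp_on J \<Longrightarrow> e * norm u \<le> norm (lin_comb a u)"
    using lin_comb_lower_bound[OF ind] by blast
  obtain N where N: "\<And>n. n \<ge> N \<Longrightarrow> u n \<in> supp_on J"
    using supp by (auto simp: eventually_sequentially)
  have "Cauchy u"
  proof (rule metric_CauchyI)
    fix r :: real assume "r > 0"
    then have "e * r > 0" using e by simp
    then obtain M where M: "\<And>m n. m \<ge> M \<Longrightarrow> n \<ge> M \<Longrightarrow> dist (lin_comb a (u m)) (lin_comb a (u n)) < e * r"
      using LIMSEQ_imp_Cauchy[OF t] unfolding Cauchy_def by meson
    show "\<exists>M. \<forall>m\<ge>M. \<forall>n\<ge>M. dist (u m) (u n) < r"
    \<comment> \<open>Beyond \<open>N\<close> the differences \<open>u m - u n\<close> lie in the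
      subspace \<open>supp_on J\<close>, so the lower bound \<open>e\<close> applies to
      them.\<close>
    proof (intro exI[of _ "max M N"] allI impI)
      fix m n assume "max M N \<le> m" "max M N \<le> n"
      then have "e * norm (u m - u n) < e * r"
        using e(2)[of "u m - u n"] N M[of m n] subspace_diff[OF subspace_supp_on, of "u m" J "u n"]
        by (simp add: dist_norm linear_diff[OF linear_lin_comb])
      then show "dist (u m) (u n) < r" using e(1) by (simp add: dist_norm)
    qed
  qed
  then obtain l where l: "u \<longlonglongrightarrow> l" using Cauchy_convergent convergentD by blast
  moreover have "(\<lambda>n. lin_comb a (u n)) \<longlonglongrightarrow> lin_comb a l"
    using linear_lin_comb l by (metis linear_conv_bounded_linear bounded_linear.tendsto)
  ultimately show ?thesis using that LIMSEQ_unique[OF t] by blast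
qed

lemma span_image_lin_comb:
  assumes "w \<in> span (a ` J)"
  obtains u where "u \<in> supp_on J" "lin_comb a u = w"
proof -
  have "a i \<in> lin_comb a ` supp_on J" if "i \<in> J" for i
  proof
    show "axis i 1 \<in> supp_on J" using that by (auto simp: supp_on_def axis_def)
    have "(\<Sum>j\<in>UNIV. axis i 1 $ j *\<^sub>R a j) = (\<Sum>j\<in>UNIV. if j = i then a j else 0)"
      by (intro sum.cong) (auto simp: axis_def)
    then show "a i = lin_comb a (axis i 1)" by (simp add: lin_comb_def)
  qed
  then have "span (a ` J) \<subseteq> lin_comb a ` supp_on J"
    by (intro span_minimal linear_subspace_image linear_lin_comb subspace_supp_on) auto
  with assms that show ?thesis by auto
qed

text \<open>\<open>e n\<close> is the projection of \<open>d\<close> onto the orthogonal complement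
  of the span of the \<open>b n i\<close> with \<open>i\<close> in \<open>J\<close>. The removed
  part \<open>w n\<close> is small: its squared norm is \<open>w n \<bullet> d\<close>, a
  combination of the numbers \<open>b n i \<bullet> d\<close>, which tend to 0, with coefficients
  bounded by \<open>norm (w n) / c\<close>.\<close>

lemma tangent_approximation:
  assumes ind: "lin_indep a J" and lim: "\<And>i::'k::finite. (\<lambda>n. b n i) \<longlonglongrightarrow> a i"
    and d: "\<And>i. i \<in> J \<Longrightarrow> a i \<bullet> d = 0"
  obtains e where "e \<longlonglongrightarrow> d" "\<And>n i. i \<in> J \<Longrightarrow> b n i \<bullet> e n = 0"
proof -
  have "\<exists>u e. u \<in> supp_on J \<and> (\<forall>v \<in> span (b n ` J). orthogonal e v)
      \<and> lin_comb (b n) u \<in> span (b n ` J) \<and> d = lin_comb (b n) u + e" for n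
  proof -
    obtain w e where w: "w \<in> span (b n ` J)" "\<And>v. v \<in> span (b n ` J) \<Longrightarrow> orthogonal e v" "d = w + e"
      using orthogonal_subspace_decomp_exists[of "b n ` J" d] by blast
    with span_image_lin_comb[OF w(1)] show ?thesis by metis
  qed
  then obtain u e where ue: "\<And>n. u n \<in> supp_on J \<and> (\<forall>v \<in> span (b n ` J). orthogonal (e n) v)
      \<and> lin_comb (b n) (u n) \<in> span (b n ` J) \<and> d = lin_comb (b n) (u n) + e n"
    by metis
  define w where "w n = lin_comb (b n) (u n)" for n
  have *: "u n \<in> supp_on J" "w n = lin_comb (b n) (u n)"
    "\<forall>v \<in> span (b n ` J). orthogonal (e n) v" "w n \<in> span (b n ` J)" "d = w n + e n" for n
    using ue[of n] by (auto simp: w_def)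
  obtain c where c: "c > 0"
    "\<forall>\<^sub>F n in sequentially. \<forall>u \<in> supp_on J. c * norm u \<le> norm (lin_comb (b n) u)"
    using lin_comb_lower_bound_eventually[OF ind lim] by blast
  \<comment> \<open>\<open>r n\<close> measures how far \<open>d\<close> is from being orthogonal to
    the perturbed family.\<close>
  define r where "r n = (\<Sum>i\<in>J. \<bar>b n i \<bullet> d\<bar>)" for n
  have "r \<longlonglongrightarrow> (\<Sum>i\<in>J. \<bar>a i \<bullet> d\<bar>)" unfolding r_def by (intro tendsto_intros lim)
  then have r0: "(\<lambda>n. r n / c) \<longlonglongrightarrow> 0" using d by (auto intro: tendsto_divide_zero)
  have "\<forall>\<^sub>F n in sequentially. norm (w n) \<le> r n / c"
    using c(2)
  proof eventually_elim
    case (elim n)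
    have "e n \<bullet> w n = 0" using *(3,4)[of n] by (auto simp: orthogonal_def)
    then have "(norm (w n))\<^sup>2 = w n \<bullet> d"
      using *(5)[of n] by (simp add: inner_add_right power2_norm_eq_inner inner_commute)
    also have "\<dots> = (\<Sum>i\<in>UNIV. u n $ i * (b n i \<bullet> d))"
      by (simp add: *(2) lin_comb_def inner_sum_left)
    also have "\<dots> = (\<Sum>i\<in>J. u n $ i * (b n i \<bullet> d))"
      using *(1)[of n] by (intro sum.mono_neutral_right) (auto simp: supp_on_def)
    also have "\<dots> \<le> (\<Sum>i\<in>J. norm (u n) * \<bar>b n i \<bullet> d\<bar>)"
    proof (rule sum_mono)
      fix i
      have "u n $ i * (b n i \<bullet> d) \<le> \<bar>u n $ i\<bar> * \<bar>b n i \<bullet> d\<bar>"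
        unfolding abs_mult[symmetric] by (rule abs_ge_self)
      also have "\<dots> \<le> norm (u n) * \<bar>b n i \<bullet> d\<bar>"
        by (intro mult_right_mono component_le_norm_cart) simp
      finally show "u n $ i * (b n i \<bullet> d) \<le> norm (u n) * \<bar>b n i \<bullet> d\<bar>" .
    qed
    also have "\<dots> = norm (u n) * r n" by (simp add: r_def sum_distrib_left)
    also have "\<dots> \<le> norm (w n) / c * r n"
      using elim *(1,2)[of n] c(1) by (intro mult_right_mono) (auto simp: r_def field_simps sum_nonneg)
    finally have "norm (w n) * norm (w n) \<le> norm (w n) * (r n / c)" by (simp add: power2_eq_square)
    moreover have "0 \<le> r n / c" using c(1) by (simp add: r_def sum_nonneg)
    ultimately show ?case
      by (cases "w n = 0") (simp, rule mult_left_le_imp_le[of "norm (w n)"], auto)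
  qed
  then have "w \<longlonglongrightarrow> 0" using r0 by (rule Lim_null_comparison)
  then have "(\<lambda>n. d - w n) \<longlonglongrightarrow> d - 0" by (intro tendsto_intros)
  moreover have "(\<lambda>n. d - w n) = e" 
  proof
    show "d - w n = e n" for n using *(5)[of n] by (simp add: algebra_simps)
  qed
  ultimately have "e \<longlonglongrightarrow> d" by simp
  moreover have "b n i \<bullet> e n = 0" if "i \<in> J" for n i
  proof -
    have "b n i \<in> span (b n ` J)" using that by (intro span_base imageI)
    then show ?thesis using *(3)[of n] by (simp add: orthogonal_def inner_commute[of "b n i"])
  qed
  ultimately show ?thesis using that by blast
qed

subsection \<open>KKT multipliers by quadratic penalization\<close>

text \<open>This smooth majorant of the penalty term touches it at \<open>s = t\<close>, so a minimizer of the penalized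
  objective is stationary for the majorant; the derivative of \<open>(max 0 s)\<^sup>2\<close> is never needed.\<close>

lemma sq_max0_le: "(max 0 s)\<^sup>2 \<le> (max 0 t + (s - t))\<^sup>2" for s t :: real
proof (cases "s \<le> 0")
  case False
  then have "0 \<le> max 0 s" "max 0 s \<le> max 0 t + (s - t)" by auto
  then show ?thesis by (intro power_mono)
qed simp

text \<open>The numbers \<open>2 * K * max 0 (h i y)\<close> act as approximate multipliers: they
  are nonnegative, vanish where \<open>h i y \<le> 0\<close>, and satisfy the KKT equation up to the
  error \<open>2 *\<^sub>R (y - p)\<close> of the proximal term.\<close>

lemma penalty_stationary:
  fixes f :: "'a::euclidean_space \<Rightarrow> real" and h :: "'k::finite \<Rightarrow> 'a \<Rightarrow> real"
  assumes f: "(f has_derivative (\<lambda>v. f' \<bullet> v)) (at y)"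
    and h: "\<And>i. (h i has_derivative (\<lambda>v. h' i \<bullet> v)) (at y)"
    and "open S" "y \<in> S"
    and min: "\<And>z. z \<in> S \<Longrightarrow>
      f y + (norm (y - p))\<^sup>2 + K * (\<Sum>i\<in>UNIV. (max 0 (h i y))\<^sup>2)
      \<le> f z + (norm (z - p))\<^sup>2 + K * (\<Sum>i\<in>UNIV. (max 0 (h i z))\<^sup>2)"
    and "K \<ge> 0"
  shows "lin_comb h' (\<chi> i. 2 * K * max 0 (h i y)) = - f' - 2 *\<^sub>R (y - p)"
proof -
  define G where "G z = f z + (norm (z - p))\<^sup>2
    + K * (\<Sum>i\<in>UNIV. (max 0 (h i y) + (h i z - h i y))\<^sup>2)" for z
  define g where "g = f' + 2 *\<^sub>R (y - p) + lin_comb h' (\<chi> i. 2 * K * max 0 (h i y))"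
  have "(G has_derivative (\<lambda>v. f' \<bullet> v + 2 * ((y - p) \<bullet> v)
      + K * (\<Sum>i\<in>UNIV. 2 * max 0 (h i y) * (h' i \<bullet> v)))) (at y)"
    unfolding G_def power2_norm_eq_inner
    by (rule derivative_eq_intros f h refl | simp add: inner_commute mult_ac)+
  moreover have "(\<lambda>v. f' \<bullet> v + 2 * ((y - p) \<bullet> v)
      + K * (\<Sum>i\<in>UNIV. 2 * max 0 (h i y) * (h' i \<bullet> v))) = (\<lambda>v. g \<bullet> v)"
    by (simp add: g_def lin_comb_def inner_add_left inner_sum_left sum_distrib_left mult_ac fun_eq_iff)
  ultimately have "(G has_derivative (\<lambda>v. g \<bullet> v)) (at y)" by simp
  moreover have "G y \<le> G z" if "z \<in> S" for z
  proof -
    have "G y = f y + (norm (y - p))\<^sup>2 + K * (\<Sum>i\<in>UNIV. (max 0 (h i y))\<^sup>2)"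
      by (simp add: G_def)
    also have "\<dots> \<le> f z + (norm (z - p))\<^sup>2 + K * (\<Sum>i\<in>UNIV. (max 0 (h i z))\<^sup>2)"
      using that by (rule min)
    also have "\<dots> \<le> G z" unfolding G_def
      by (intro add_left_mono mult_left_mono sum_mono sq_max0_le \<open>K \<ge> 0\<close>)
    finally show ?thesis .
  qed
  ultimately have "(\<lambda>v. g \<bullet> v) = (\<lambda>v. 0)"
    using differential_zero_maxmin[OF \<open>y \<in> S\<close> \<open>open S\<close>] by blast
  then have "g \<bullet> g = 0" by metis
  then have "g = 0" by simp
  then show ?thesis by (simp add: g_def algebra_simps add_eq_0_iff)
qed

text \<open>Minimizers of the penalized objective on a small ball converge to \<open>p\<close> along
  a subsequence. Their approximate multipliers converge because the active gradients at
  \<open>p\<close> are independent, and the limit inherits sign and support.\<close>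

lemma kkt_multipliers_exist:
  fixes f :: "'a::euclidean_space \<Rightarrow> real" and h :: "'k::finite \<Rightarrow> 'a \<Rightarrow> real"
  assumes f: "\<And>y. (f has_derivative (\<lambda>v. f' y \<bullet> v)) (at y)" and f': "continuous_on UNIV f'"
    and h: "\<And>i y. (h i has_derivative (\<lambda>v. h' i y \<bullet> v)) (at y)"
    and h': "\<And>i. continuous_on UNIV (h' i)"
    and feas: "\<And>i. h i p \<le> 0"
    and ind: "lin_indep (\<lambda>i. h' i p) {i. h i p = 0}"
    and \<epsilon>: "\<epsilon> > 0" and min: "\<And>z. (\<And>i. h i z \<le> 0) \<Longrightarrow> z \<in> ball p \<epsilon> \<Longrightarrow> f p \<le> f z"
  obtains u :: "real ^ 'k" where "f' p + lin_comb (\<lambda>i. h' i p) u = 0"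
    "\<And>i. u $ i \<ge> 0" "u \<in> supp_on {i. h i p = 0}"
proof -
  \<comment> \<open>Half the radius keeps every limit of points of \<open>B\<close> inside the open
    ball where \<open>p\<close> is minimal.\<close>
  define B where "B = cball p (\<epsilon> / 2)"
  have cf: "continuous_on S f" for S
    using f by (meson continuous_at_imp_continuous_on has_derivative_continuous)
  have ch: "continuous_on S (h i)" for i S
    using h by (meson continuous_at_imp_continuous_on has_derivative_continuous)
  have tf: "(\<lambda>n. f (s n)) \<longlonglongrightarrow> f l" if "s \<longlonglongrightarrow> l" for s :: "nat \<Rightarrow> 'a" and l
    using continuous_on_tendsto_compose[OF cf[of UNIV] that] by simp
  have th: "(\<lambda>n. h i (s n)) \<longlonglongrightarrow> h i l" if "s \<longlonglongrightarrow> l" for s :: "nat \<Rightarrow> 'a" and l i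
    using continuous_on_tendsto_compose[OF ch[of UNIV] that] by simp
  have tf': "(\<lambda>n. f' (s n)) \<longlonglongrightarrow> f' l" if "s \<longlonglongrightarrow> l" for s :: "nat \<Rightarrow> 'a" and l
    using continuous_on_tendsto_compose[OF f' that] by simp
  have th': "(\<lambda>n. h' i (s n)) \<longlonglongrightarrow> h' i l" if "s \<longlonglongrightarrow> l" for s :: "nat \<Rightarrow> 'a" and l i
    using continuous_on_tendsto_compose[OF h' that] by simp
  define V where "V y = (\<Sum>i\<in>UNIV. (max 0 (h i y))\<^sup>2)" for y
  have tV: "(\<lambda>n. V (s n)) \<longlonglongrightarrow> V l" if "s \<longlonglongrightarrow> l" for s :: "nat \<Rightarrow> 'a" and l
    unfolding V_def by (intro tendsto_intros th that)
  have V0: "V p = 0" using feas by (simp add: V_def max_absorb1)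
  \<comment> \<open>The term \<open>(norm (y - p))\<^sup>2\<close> singles out \<open>p\<close>
    among possibly many minimizers of \<open>f\<close>, forcing the penalized minimizers towards
    it.\<close>
  define P where "P K y = f y + (norm (y - p))\<^sup>2 + K * V y" for K y
  have "\<exists>y\<in>B. \<forall>z\<in>B. P (real k) y \<le> P (real k) z" for k
    unfolding P_def V_def using \<epsilon>
    by (intro continuous_attains_inf continuous_intros cf ch) (auto simp: B_def)
  then obtain s where s: "\<And>k. s k \<in> B" "\<And>k z. z \<in> B \<Longrightarrow> P (real k) (s k) \<le> P (real k) z"
    by metis
  have sp: "f (s k) + (norm (s k - p))\<^sup>2 + real k * V (s k) \<le> f p" for k
    using s(2)[of p k] V0 \<epsilon> by (simp add: P_def B_def)
  have "\<exists>x\<in>B. \<forall>y\<in>B. f x \<le> f y"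
    using \<epsilon> by (intro continuous_attains_inf cf) (auto simp: B_def)
  then obtain m where m: "\<And>y. y \<in> B \<Longrightarrow> m \<le> f y" by blast
  obtain q r where r: "q \<in> B" "strict_mono r" "(s \<circ> r) \<longlonglongrightarrow> q"
    using s(1) compact_cball[of p "\<epsilon> / 2"] unfolding B_def compact_def by meson
  then have q: "(\<lambda>n. s (r n)) \<longlonglongrightarrow> q" by (simp add: o_def)
  have Vn: "V y \<ge> 0" for y by (auto simp: V_def sum_nonneg)
  \<comment> \<open>Comparison with \<open>p\<close>, where the penalty vanishes, and the lower
    bound \<open>m\<close> of \<open>f\<close> on \<open>B\<close> make the violation of order
    \<open>1 / n\<close>; so the cluster point \<open>q\<close> is feasible.\<close>
  have "V (s (r n)) \<le> (f p - m) / real n" if "n > 0" for n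
  proof -
    have "real n * V (s (r n)) \<le> real (r n) * V (s (r n))"
      using Vn seq_suble[OF r(2), of n] by (intro mult_right_mono) auto
    also have "\<dots> \<le> f p - m"
      using sp[of "r n"] m[OF s(1)[of "r n"]] zero_le_power2[of "norm (s (r n) - p)"] by linarith
    finally show ?thesis using that by (simp add: field_simps)
  qed
  then have "\<forall>\<^sub>F n in sequentially. V (s (r n)) \<le> (f p - m) / real n"
    using eventually_gt_at_top[of 0] by (rule eventually_mono[rotated])
  then have "V q \<le> 0"
    using tendsto_le[OF _ lim_const_over_n tV[OF q]] by simp
  then have "\<forall>i\<in>UNIV. (max 0 (h i q))\<^sup>2 = 0"
    using Vn[of q] unfolding V_def by (subst sum_nonneg_eq_0_iff[symmetric]) auto
  then have "max 0 (h i q) = 0" for i by simp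
  then have hq: "h i q \<le> 0" for i by (metis max.cobounded2)
  have "q \<in> ball p \<epsilon>" using r(1) \<epsilon> by (auto simp: B_def)
  then have "f p \<le> f q" using min hq by blast
  \<comment> \<open>Together with \<open>f p \<le> f q\<close> this leaves no room for
    \<open>norm (q - p)\<close>, so \<open>q = p\<close>.\<close>
  moreover have "f q + (norm (q - p))\<^sup>2 \<le> f p"
  proof (rule tendsto_upperbound)
    show "(\<lambda>n. f (s (r n)) + (norm (s (r n) - p))\<^sup>2) \<longlonglongrightarrow> f q + (norm (q - p))\<^sup>2"
      by (intro tendsto_intros tf q)
    have "f (s k) + (norm (s k - p))\<^sup>2 \<le> f p" for k
      using sp[of k] mult_nonneg_nonneg[OF _ Vn[of "s k"], of "real k"] by simp
    then show "\<forall>\<^sub>F n in sequentially. f (s (r n)) + (norm (s (r n) - p))\<^sup>2 \<le> f p" by simp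
  qed simp
  ultimately have "(norm (q - p))\<^sup>2 \<le> 0" by linarith
  then have "q = p" by simp
  with q have sr: "(\<lambda>n. s (r n)) \<longlonglongrightarrow> p" by simp
  define u where "u n = (\<chi> i. 2 * real (r n) * max 0 (h i (s (r n))))" for n
  \<comment> \<open>Stationarity requires the minimizer over \<open>B\<close> to lie in its
    interior, which holds once it is close to \<open>p\<close>.\<close>
  have "\<forall>\<^sub>F n in sequentially. s (r n) \<in> ball p (\<epsilon> / 2)"
    using sr \<epsilon> by (intro topological_tendstoD) auto
  then have "\<forall>\<^sub>F n in sequentially. - f' (s (r n)) - 2 *\<^sub>R (s (r n) - p) = lin_comb (\<lambda>i. h' i (s (r n))) (u n)"
  proof eventually_elim
    case (elim n)
    show ?case unfolding u_def
    proof (rule penalty_stationary[OF f h open_ball elim, symmetric])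
      fix z assume "z \<in> ball p (\<epsilon> / 2)"
      then show "f (s (r n)) + (norm (s (r n) - p))\<^sup>2 + real (r n) * (\<Sum>i\<in>UNIV. (max 0 (h i (s (r n))))\<^sup>2)
          \<le> f z + (norm (z - p))\<^sup>2 + real (r n) * (\<Sum>i\<in>UNIV. (max 0 (h i z))\<^sup>2)"
        using s(2)[of z "r n"] unfolding P_def V_def B_def by auto
    qed simp
  qed
  moreover have "(\<lambda>n. - f' (s (r n)) - 2 *\<^sub>R (s (r n) - p)) \<longlonglongrightarrow> - f' p - 2 *\<^sub>R (p - p)"
    by (intro tendsto_intros tf' sr)
  ultimately have lim: "(\<lambda>n. lin_comb (\<lambda>i. h' i (s (r n))) (u n)) \<longlonglongrightarrow> - f' p"
    by (simp add: tendsto_cong)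
  have supp: "\<forall>\<^sub>F n in sequentially. u n \<in> supp_on {i. h i p = 0}"
  proof -
    \<comment> \<open>A constraint inactive at \<open>p\<close> is strictly negative nearby, so its
      penalty multiplier is eventually exactly 0.\<close>
    have "\<forall>\<^sub>F n in sequentially. h i p \<noteq> 0 \<longrightarrow> u n $ i = 0" for i
    proof (cases "h i p = 0")
      case False
      then have "\<forall>\<^sub>F n in sequentially. h i (s (r n)) < 0"
        using feas[of i] by (intro order_tendstoD(2)[OF th[OF sr]]) auto
      then show ?thesis by eventually_elim (simp add: u_def)
    qed simp
    then show ?thesis unfolding supp_on_def by (simp add: eventually_all_finite)
  qed
  obtain l where l: "u \<longlonglongrightarrow> l" "lin_comb (\<lambda>i. h' i p) l = - f' p"
    using coefficients_converge[OF ind th'[OF sr] supp lim] by blast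
  have "l \<in> supp_on {i. h i p = 0}"
    using Lim_in_closed_set[OF closed_subspace[OF subspace_supp_on] supp _ l(1)] by simp
  moreover have "l $ i \<ge> 0" for i
    by (rule tendsto_lowerbound[OF tendsto_vec_nth[OF l(1)]]) (auto simp: u_def)
  ultimately show ?thesis by (intro that[of l]) (auto simp: l(2))
qed

section \<open>KKT pairs and the Lagrangian of the lower-level problem\<close>

lemma LICQ_lin_indep:
  fixes h :: "'k::finite \<Rightarrow> real ^ 'n \<Rightarrow> real ^ 'm \<Rightarrow> real"
  assumes "LICQ h x" "y \<in> feasible_set h x"
  shows "lin_indep (\<lambda>i. grad (h i x) y) (active_set h x y)"
  using assms by (simp add: LICQ_def lin_indep_def)

text \<open>LICQ is the constraint qualification that supplies a multiplier;
  \<open>uniform_SOSC\<close> speaks only of local minimizers paired with one.\<close>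

lemma local_minimizer_KKT_pair:
  fixes g :: "real ^ 'n \<Rightarrow> real ^ 'm \<Rightarrow> real"
    and h :: "'k::finite \<Rightarrow> real ^ 'n \<Rightarrow> real ^ 'm \<Rightarrow> real"
  assumes g: "smooth_on (X \<times> UNIV) (\<lambda>(x, y). g x y)"
    and h: "\<And>i. smooth_on (X \<times> UNIV) (\<lambda>(x, y). h i x y)"
    and x: "x \<in> X" and "LICQ h x" and y: "local_minimizer g h x y"
  obtains lam where "KKT_pair g h x y lam"
proof -
  have feas: "y \<in> feasible_set h x" using y by (simp add: local_minimizer_def)
  obtain \<epsilon> where \<epsilon>: "\<epsilon> > 0" "\<And>z. z \<in> feasible_set h x \<inter> ball y \<epsilon> \<Longrightarrow> g x y \<le> g x z"
    using y by (auto simp: local_minimizer_def)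
  have c: "continuous_on UNIV (grad (f x))" if "smooth_on (X \<times> UNIV) (\<lambda>(x, y). f x y)" for f :: "real ^ 'n \<Rightarrow> real ^ 'm \<Rightarrow> real"
    using smooth_on_hessian[OF that x]
    by (meson continuous_at_imp_continuous_on has_derivative_continuous)
  obtain u :: "real ^ 'k" where u: "grad (g x) y + lin_comb (\<lambda>i. grad (h i x) y) u = 0"
    "\<And>i. u $ i \<ge> 0" "u \<in> supp_on {i. h i x y = 0}"
  proof (rule kkt_multipliers_exist[OF smooth_on_grad[OF g x] c[OF g] smooth_on_grad[OF h x] c[OF h]])
    show "lin_indep (\<lambda>i. grad (h i x) y) {i. h i x y = 0}"
      using LICQ_lin_indep[OF \<open>LICQ h x\<close> feas] by (simp add: active_set_def)
  qed (use feas \<epsilon> in \<open>auto simp: feasible_set_def\<close>)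
  then have "KKT_pair g h x y u"
    using feas unfolding KKT_pair_def lin_comb_def supp_on_def feasible_set_def by auto
  then show ?thesis by (rule that)
qed

text \<open>The third claim reduces the Hessian of the Lagrangian to those of \<open>g\<close> and
  \<open>h i\<close>, so that it converges when \<open>x\<close>, \<open>y\<close> and the
  multipliers do.\<close>

lemma lagrangian_has_derivative:
  fixes g :: "real ^ 'n \<Rightarrow> real ^ 'm \<Rightarrow> real"
    and h :: "'k::finite \<Rightarrow> real ^ 'n \<Rightarrow> real ^ 'm \<Rightarrow> real"
    and lam :: "real ^ 'k"
  assumes g: "smooth_on (X \<times> UNIV) (\<lambda>(x, y). g x y)"
    and h: "\<And>i. smooth_on (X \<times> UNIV) (\<lambda>(x, y). h i x y)"
    and x: "x \<in> X"
  defines "L \<equiv> \<lambda>z. lagrangian g h x z lam"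
  shows "(L has_derivative (\<lambda>v. (grad (g x) y + (\<Sum>i\<in>UNIV. lam $ i *\<^sub>R grad (h i x) y)) \<bullet> v)) (at y)"
    and "((\<lambda>z. grad (g x) z + (\<Sum>i\<in>UNIV. lam $ i *\<^sub>R grad (h i x) z)) has_derivative
      (\<lambda>v. hessian L y *v v)) (at y)"
    and "hessian L y = hessian (g x) y + (\<Sum>i\<in>UNIV. lam $ i *\<^sub>R hessian (h i x) y)"
proof -
  have 1: "(L has_derivative (\<lambda>v. (grad (g x) y + (\<Sum>i\<in>UNIV. lam $ i *\<^sub>R grad (h i x) y)) \<bullet> v)) (at y)" for y
  proof -
    have "(L has_derivative (\<lambda>v. grad (g x) y \<bullet> v + (\<Sum>i\<in>UNIV. lam $ i * (grad (h i x) y \<bullet> v)))) (at y)"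
      unfolding L_def lagrangian_def
      by (intro derivative_intros smooth_on_grad[OF g x] smooth_on_grad[OF h x])
    then show ?thesis by (simp add: inner_add_left inner_sum_left)
  qed
  then show "(L has_derivative (\<lambda>v. (grad (g x) y + (\<Sum>i\<in>UNIV. lam $ i *\<^sub>R grad (h i x) y)) \<bullet> v)) (at y)" .
  have gr: "grad L = (\<lambda>z. grad (g x) z + (\<Sum>i\<in>UNIV. lam $ i *\<^sub>R grad (h i x) z))"
    by (rule ext) (simp add: vec_eq_iff grad_def[of L] inner_axis flip: frechet_derivative_at[OF 1])
  have "((\<lambda>z. grad (g x) z + (\<Sum>i\<in>UNIV. lam $ i *\<^sub>R grad (h i x) z)) has_derivative
      (\<lambda>v. hessian (g x) y *v v + (\<Sum>i\<in>UNIV. lam $ i *\<^sub>R (hessian (h i x) y *v v)))) (at y)"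
    by (intro derivative_intros smooth_on_hessian[OF g x] smooth_on_hessian[OF h x])
  moreover have "(\<Sum>i\<in>I. A i) *v v = (\<Sum>i\<in>I. A i *v v)" for A :: "'k \<Rightarrow> real ^ 'm ^ 'm" and v I
    by (induction I rule: infinite_finite_induct) (auto simp: matrix_vector_mult_add_rdistrib)
  ultimately have 2: "((\<lambda>z. grad (g x) z + (\<Sum>i\<in>UNIV. lam $ i *\<^sub>R grad (h i x) z)) has_derivative
      (\<lambda>v. (hessian (g x) y + (\<Sum>i\<in>UNIV. lam $ i *\<^sub>R hessian (h i x) y)) *v v)) (at y)"
    by (simp add: matrix_vector_mult_add_rdistrib scaleR_matrix_vector_assoc)
  show 3: "hessian L y = hessian (g x) y + (\<Sum>i\<in>UNIV. lam $ i *\<^sub>R hessian (h i x) y)"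
    unfolding hessian_def[of L] gr jacobian_def frechet_derivative_at[OF 2, symmetric] by simp
  show "((\<lambda>z. grad (g x) z + (\<Sum>i\<in>UNIV. lam $ i *\<^sub>R grad (h i x) z)) has_derivative
      (\<lambda>v. hessian L y *v v)) (at y)"
    unfolding 3 by (rule 2)
qed

text \<open>Constraints inactive at the limit are inactive eventually, so by complementarity the
  multipliers are eventually supported on the limiting active set. Stationarity gives convergent
  combinations of gradients, and LICQ at \<open>x0\<close> turns this into convergence of the
  multipliers.\<close>

lemma KKT_pairs_converge:
  fixes g :: "real ^ 'n \<Rightarrow> real ^ 'm \<Rightarrow> real"
    and h :: "'k::finite \<Rightarrow> real ^ 'n \<Rightarrow> real ^ 'm \<Rightarrow> real"
  assumes g: "smooth_on (X \<times> UNIV) (\<lambda>(x, y). g x y)"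
    and h: "\<And>i. smooth_on (X \<times> UNIV) (\<lambda>(x, y). h i x y)"
    and X: "\<And>n. x n \<in> X" "x0 \<in> X" and "LICQ h x0"
    and kkt: "\<And>n. KKT_pair g h (x n) (y n) (lam n)"
    and lim: "x \<longlonglongrightarrow> x0" "y \<longlonglongrightarrow> y0"
  obtains lam0 where "lam \<longlonglongrightarrow> lam0" "KKT_pair g h x0 y0 lam0"
    "\<forall>\<^sub>F n in sequentially. active_set h (x n) (y n) \<subseteq> active_set h x0 y0"
proof -
  have xy: "(\<lambda>n. (x n, y n)) \<longlonglongrightarrow> (x0, y0)" by (intro tendsto_intros lim)
  have tg: "(\<lambda>n. grad (f (x n)) (y n)) \<longlonglongrightarrow> grad (f x0) y0"
    if "smooth_on (X \<times> UNIV) (\<lambda>(x, y). f x y)" for f :: "real ^ 'n \<Rightarrow> real ^ 'm \<Rightarrow> real"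
    using continuous_on_tendsto_compose[OF smooth_on_continuous_grad[OF that] xy] X by simp
  have th: "(\<lambda>n. h i (x n) (y n)) \<longlonglongrightarrow> h i x0 y0" for i
    using continuous_on_tendsto_compose[OF smooth_on_continuous[OF h] xy] X by simp
  have K: "grad (g (x n)) (y n) + lin_comb (\<lambda>i. grad (h i (x n)) (y n)) (lam n) = 0"
    "h i (x n) (y n) \<le> 0" "lam n $ i \<ge> 0" "lam n $ i * h i (x n) (y n) = 0" for n i
    using kkt[of n] by (auto simp: KKT_pair_def lin_comb_def)
  have h0: "h i x0 y0 \<le> 0" for i
    by (rule tendsto_upperbound[OF th]) (auto simp: K)
  then have feas: "y0 \<in> feasible_set h x0" by (simp add: feasible_set_def)
  have "\<forall>\<^sub>F n in sequentially. h i x0 y0 \<noteq> 0 \<longrightarrow> h i (x n) (y n) \<noteq> 0" for i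
  proof (cases "h i x0 y0 = 0")
    case False
    then have "\<forall>\<^sub>F n in sequentially. h i (x n) (y n) < 0"
      using h0[of i] by (intro order_tendstoD(2)[OF th]) auto
    then show ?thesis by eventually_elim auto
  qed simp
  then have "\<forall>\<^sub>F n in sequentially. \<forall>i. h i x0 y0 \<noteq> 0 \<longrightarrow> h i (x n) (y n) \<noteq> 0"
    by (rule eventually_all_finite)
  then have act: "\<forall>\<^sub>F n in sequentially. active_set h (x n) (y n) \<subseteq> active_set h x0 y0"
    by eventually_elim (auto simp: active_set_def)
  then have "\<forall>\<^sub>F n in sequentially. lam n \<in> supp_on (active_set h x0 y0)"
    by eventually_elim (use K(4) in \<open>force simp: supp_on_def active_set_def\<close>)
  moreover have "(\<lambda>n. - grad (g (x n)) (y n)) \<longlonglongrightarrow> - grad (g x0) y0"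
    by (intro tendsto_intros tg g)
  then have "(\<lambda>n. lin_comb (\<lambda>i. grad (h i (x n)) (y n)) (lam n)) \<longlonglongrightarrow> - grad (g x0) y0"
    using K(1) by (simp add: add_eq_0_iff)
  ultimately obtain l where l: "lam \<longlonglongrightarrow> l" "lin_comb (\<lambda>i. grad (h i x0) y0) l = - grad (g x0) y0"
    using coefficients_converge[OF LICQ_lin_indep[OF \<open>LICQ h x0\<close> feas] tg[OF h]] by blast
  have "l $ i \<ge> 0" for i
    by (rule tendsto_lowerbound[OF tendsto_vec_nth[OF l(1)]]) (auto simp: K)
  moreover have "l $ i * h i x0 y0 = 0" for i
  proof -
    have "(\<lambda>n. lam n $ i * h i (x n) (y n)) \<longlonglongrightarrow> l $ i * h i x0 y0"
      by (intro tendsto_intros th l)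
    then show ?thesis using K(4) LIMSEQ_unique[OF tendsto_const] by fastforce
  qed
  ultimately have "KKT_pair g h x0 y0 l"
    using h0 l(2) by (simp add: KKT_pair_def lin_comb_def)
  with that l(1) act show ?thesis by blast
qed

subsection \<open>Uniform quadratic growth\<close>

lemma quadratic_growth_sequential:
  fixes g :: "real ^ 'n \<Rightarrow> real ^ 'm \<Rightarrow> real"
    and h :: "'k::finite \<Rightarrow> real ^ 'n \<Rightarrow> real ^ 'm \<Rightarrow> real"
    and p y :: "nat \<Rightarrow> real ^ 'm"
  assumes g: "smooth_on (X \<times> UNIV) (\<lambda>(x, y). g x y)"
    and h: "\<And>i. smooth_on (X \<times> UNIV) (\<lambda>(x, y). h i x y)"
    and X: "\<And>n. x n \<in> X" "x0 \<in> X"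
    and licq: "\<And>x. x \<in> X \<Longrightarrow> LICQ h x" and scsc: "SCSC g h x0"
    and sosc: "uniform_SOSC g h X"
    and p: "\<And>n. local_minimizer g h (x n) (p n)"
    and y: "\<And>n. y n \<in> feasible_set h (x n)" "\<And>n. y n \<noteq> p n"
    and "\<epsilon> \<longlonglongrightarrow> 0"
    and "x \<longlonglongrightarrow> x0" "p \<longlonglongrightarrow> p0" "y \<longlonglongrightarrow> p0"
    and dir: "(\<lambda>n. (y n - p n) /\<^sub>R norm (y n - p n)) \<longlonglongrightarrow> d"
  shows "\<exists>n. g (x n) (y n) \<ge> g (x n) (p n) + \<epsilon> n * (norm (y n - p n))\<^sup>2"
proof (rule ccontr)
  assume "\<not> ?thesis"
  then have flat: "g (x n) (y n) < g (x n) (p n) + \<epsilon> n * (norm (y n - p n))\<^sup>2" for n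
    by (auto simp: not_le)
  have "\<exists>lam. KKT_pair g h (x n) (p n) lam" for n
    using local_minimizer_KKT_pair[OF g h X(1) licq[OF X(1)] p] by blast
  then obtain lam where kkt: "\<And>n. KKT_pair g h (x n) (p n) (lam n)" by metis
  obtain lam0 where lam0: "lam \<longlonglongrightarrow> lam0" "KKT_pair g h x0 p0 lam0"
    "\<forall>\<^sub>F n in sequentially. active_set h (x n) (p n) \<subseteq> active_set h x0 p0"
    using KKT_pairs_converge[OF g h X licq[OF X(2)] kkt \<open>x \<longlonglongrightarrow> x0\<close> \<open>p \<longlonglongrightarrow> p0\<close>] by blast
  have K: "h i (x n) (p n) \<le> 0" "lam n $ i \<ge> 0" "lam n $ i * h i (x n) (p n) = 0"
    "grad (g (x n)) (p n) + (\<Sum>i\<in>UNIV. lam n $ i *\<^sub>R grad (h i (x n)) (p n)) = 0" for n i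
    using kkt[of n] by (auto simp: KKT_pair_def)
  define J where "J = active_set h x0 p0"
  define t where "t n = norm (y n - p n)" for n
  \<comment> \<open>Polar form of the displacement: length \<open>t n\<close> tending to 0, unit
    direction \<open>D n\<close> tending to \<open>d\<close>.\<close>
  define D where "D n = (y n - p n) /\<^sub>R t n" for n
  have t: "t n > 0" for n using y(2) by (simp add: t_def)
  have yD: "y n - p n = t n *\<^sub>R D n" for n using t[of n] by (simp add: D_def)
  have Dlim: "D \<longlonglongrightarrow> d" using dir by (simp add: D_def[abs_def] t_def[abs_def])
  have "norm d = 1"
    using tendsto_norm[OF Dlim] t LIMSEQ_unique[OF _ tendsto_const]
    by (fastforce simp: D_def t_def)
  have tlim: "t \<longlonglongrightarrow> 0"
    using tendsto_norm[OF tendsto_diff[OF \<open>y \<longlonglongrightarrow> p0\<close> \<open>p \<longlonglongrightarrow> p0\<close>]]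
    by (simp add: t_def[abs_def])
  have seg: "z \<longlonglongrightarrow> p0" if "\<And>n. dist (z n) (p n) \<le> dist (y n) (p n)" for z
  proof -
    have "\<forall>\<^sub>F n in sequentially. norm (z n - p n) \<le> t n"
      using that by (simp add: t_def dist_norm)
    then have "(\<lambda>n. z n - p n) \<longlonglongrightarrow> 0" using tlim by (rule Lim_null_comparison)
    from tendsto_add[OF this \<open>p \<longlonglongrightarrow> p0\<close>] show ?thesis by simp
  qed
  have tgrad: "(\<lambda>n. grad (f (x n)) (z n)) \<longlonglongrightarrow> grad (f x0) p0"
    if "smooth_on (X \<times> UNIV) (\<lambda>(x, y). f x y)" "z \<longlonglongrightarrow> p0"
    for f :: "real ^ 'n \<Rightarrow> real ^ 'm \<Rightarrow> real" and z
    using continuous_on_tendsto_compose[OF smooth_on_continuous_grad[OF that(1)]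
        tendsto_Pair[OF \<open>x \<longlonglongrightarrow> x0\<close> that(2)]] X by simp
  have thess: "(\<lambda>n. hessian (f (x n)) (z n)) \<longlonglongrightarrow> hessian (f x0) p0"
    if "smooth_on (X \<times> UNIV) (\<lambda>(x, y). f x y)" "z \<longlonglongrightarrow> p0"
    for f :: "real ^ 'n \<Rightarrow> real ^ 'm \<Rightarrow> real" and z
    using continuous_on_tendsto_compose[OF smooth_on_continuous_hessian[OF that(1)]
        tendsto_Pair[OF \<open>x \<longlonglongrightarrow> x0\<close> that(2)]] X by simp
  define H where "H n z = hessian (\<lambda>z. lagrangian g h (x n) z (lam n)) z" for n z
  define H0 where "H0 = hessian (\<lambda>z. lagrangian g h x0 z lam0) p0"
  have tH: "(\<lambda>n. H n (z n)) \<longlonglongrightarrow> H0" if "z \<longlonglongrightarrow> p0" for z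
    unfolding H_def H0_def lagrangian_has_derivative(3)[where h = h, OF g h X(1)]
      lagrangian_has_derivative(3)[where h = h, OF g h X(2)]
    by (intro tendsto_intros thess g h that tendsto_vec_nth lam0)
  have tquad: "(\<lambda>n. e n \<bullet> (H n (z n) *v e n)) \<longlonglongrightarrow> d \<bullet> (H0 *v d)"
    if "z \<longlonglongrightarrow> p0" "e \<longlonglongrightarrow> d" for z e
    unfolding matrix_vector_mult_def
    by (intro tendsto_intros tH that tendsto_vec_lambda)
  \<comment> \<open>Stationarity of the KKT pair removes the first-order term of the expansion at
    \<open>p n\<close>.\<close>
  have "\<exists>z. dist z (p n) \<le> dist (y n) (p n) \<and>
    lagrangian g h (x n) (y n) (lam n) = lagrangian g h (x n) (p n) (lam n)
      + (y n - p n) \<bullet> (H n z *v (y n - p n)) / 2" for n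
    using segment_taylor2[OF lagrangian_has_derivative(1,2)
        [where g = g and h = h and x = "x n" and lam = "lam n", OF g h X(1)], where y = "p n" and w = "y n"]
    unfolding K(4) H_def by simp
  then obtain z where z: "\<And>n. dist (z n) (p n) \<le> dist (y n) (p n)"
    "\<And>n. lagrangian g h (x n) (y n) (lam n) = lagrangian g h (x n) (p n) (lam n)
      + (y n - p n) \<bullet> (H n (z n) *v (y n - p n)) / 2" by metis
  define q where "q n = D n \<bullet> (H n (z n) *v D n)" for n
  have qlim: "q \<longlonglongrightarrow> d \<bullet> (H0 *v d)"
    unfolding q_def by (intro tquad seg z Dlim)
  have hy: "h i (x n) (y n) \<le> 0" for i n using y(1) by (auto simp: feasible_set_def)
  \<comment> \<open>By complementarity the Lagrangian at \<open>p n\<close> equals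
    \<open>g (x n) (p n)\<close>. Inserting the expansion into \<open>flat\<close> bounds the sum of
    the constraint terms, each nonnegative, plus the curvature term.\<close>
  have main: "(\<Sum>i\<in>UNIV. - lam n $ i * h i (x n) (y n)) + (t n)\<^sup>2 * q n / 2 < \<epsilon> n * (t n)\<^sup>2" for n
  proof -
    have "lagrangian g h (x n) (p n) (lam n) = g (x n) (p n)"
      by (simp add: lagrangian_def K(3))
    moreover have "(y n - p n) \<bullet> (H n (z n) *v (y n - p n)) = (t n)\<^sup>2 * q n"
      by (simp add: yD q_def power2_eq_square matrix_vector_mult_scaleR)
    ultimately have "g (x n) (y n) + (\<Sum>i\<in>UNIV. lam n $ i * h i (x n) (y n))
        = g (x n) (p n) + (t n)\<^sup>2 * q n / 2"
      using z(2)[of n] by (simp add: lagrangian_def)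
    then show ?thesis using flat[of n] by (simp add: sum_negf t_def)
  qed
  have nn: "- lam n $ i * h i (x n) (y n) \<ge> 0" for i n
    using mult_nonneg_nonpos[OF K(2) hy, of n i] by simp
  \<comment> \<open>Drop the nonnegative constraint terms and divide by
    \<open>(t n)\<^sup>2\<close>.\<close>
  have "q n / 2 < \<epsilon> n" for n
  proof -
    have "(\<Sum>i\<in>UNIV. - lam n $ i * h i (x n) (y n)) \<ge> 0" by (intro sum_nonneg nn)
    with main[of n] have "(t n)\<^sup>2 * (q n / 2) < (t n)\<^sup>2 * \<epsilon> n" by (simp add: mult.commute)
    then show ?thesis using t[of n] by (simp only: mult_less_cancel_left_pos zero_less_power)
  qed
  then have "\<forall>\<^sub>F n in sequentially. q n \<le> \<epsilon> n * 2" by (simp add: less_imp_le)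
  then have curv: "d \<bullet> (H0 *v d) \<le> 0"
    using tendsto_le[OF _ tendsto_mult_right[OF \<open>\<epsilon> \<longlonglongrightarrow> 0\<close>] qlim] by simp
  have tangent: "grad (h i x0) p0 \<bullet> d = 0" if "i \<in> J" for i
  proof -
    have "\<exists>z. dist z (p n) \<le> dist (y n) (p n) \<and>
        h i (x n) (y n) = h i (x n) (p n) + grad (h i (x n)) z \<bullet> (y n - p n)" for n
      by (rule segment_mean_value[OF smooth_on_grad[OF h X(1)]])
    then obtain w where w: "\<And>n. dist (w n) (p n) \<le> dist (y n) (p n)"
      "\<And>n. h i (x n) (y n) = h i (x n) (p n) + grad (h i (x n)) (w n) \<bullet> (y n - p n)" by metis
    \<comment> \<open>Complementarity cancels the value of \<open>h i\<close> at \<open>p n\<close>,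
      leaving a term of first order in \<open>t n\<close>.\<close>
    have eq: "- lam n $ i * h i (x n) (y n) = t n * - (lam n $ i * (grad (h i (x n)) (w n) \<bullet> D n))" for n
      unfolding w(2) using K(3)[of n i] by (simp add: yD distrib_left)
    have lim: "(\<lambda>n. - (lam n $ i * (grad (h i (x n)) (w n) \<bullet> D n)))
        \<longlonglongrightarrow> - (lam0 $ i * (grad (h i x0) p0 \<bullet> d))"
      by (intro tendsto_intros tendsto_vec_nth lam0 tgrad h seg w Dlim)
    have "0 \<le> - (lam n $ i * (grad (h i (x n)) (w n) \<bullet> D n))" for n
      using nn[of n i] t[of n] unfolding eq by (simp only: zero_le_mult_iff) linarith
    then have "0 \<le> - (lam0 $ i * (grad (h i x0) p0 \<bullet> d))"
      by (intro tendsto_lowerbound[OF lim]) auto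
    \<comment> \<open>One constraint term is at most the whole sum, which by \<open>main\<close> is
      of second order in \<open>t n\<close>. Dividing by \<open>t n\<close> leaves a bound that
      still tends to 0; its limit is kept as a product of limits.\<close>
    moreover have "- (lam0 $ i * (grad (h i x0) p0 \<bullet> d)) \<le> 0 * (0 - d \<bullet> (H0 *v d) / 2)"
    proof (rule tendsto_le[OF _ _ lim])
      show "(\<lambda>n. t n * (\<epsilon> n - q n / 2)) \<longlonglongrightarrow> 0 * (0 - d \<bullet> (H0 *v d) / 2)"
        by (intro tendsto_intros tlim qlim \<open>\<epsilon> \<longlonglongrightarrow> 0\<close>) simp
      have "- (lam n $ i * (grad (h i (x n)) (w n) \<bullet> D n)) \<le> t n * (\<epsilon> n - q n / 2)" for n
      proof -
        have "- lam n $ i * h i (x n) (y n) \<le> (\<Sum>i\<in>UNIV. - lam n $ i * h i (x n) (y n))"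
          by (rule member_le_sum[OF _ nn]) simp_all
        also have "\<dots> \<le> t n * (t n * (\<epsilon> n - q n / 2))"
          using main[of n] by (simp add: power2_eq_square algebra_simps)
        finally show ?thesis using t[of n] unfolding eq by (simp only: mult_le_cancel_left_pos)
      qed
      then show "\<forall>\<^sub>F n in sequentially.
          - (lam n $ i * (grad (h i (x n)) (w n) \<bullet> D n)) \<le> t n * (\<epsilon> n - q n / 2)" by simp
    qed simp
    ultimately have "lam0 $ i * (grad (h i x0) p0 \<bullet> d) = 0" by simp
    \<comment> \<open>Strict complementarity at the limit pair turns the vanishing product into
      orthogonality.\<close>
    moreover have "lam0 $ i > 0"
      using scsc lam0(2) that unfolding SCSC_def J_def active_set_def by force
    ultimately show ?thesis by simp
  qed
  have "p0 \<in> feasible_set h x0" using lam0(2) by (auto simp: KKT_pair_def feasible_set_def)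
  from tangent_approximation[OF LICQ_lin_indep[OF licq[OF X(2)] this] tgrad[OF h \<open>p \<longlonglongrightarrow> p0\<close>]] tangent
  obtain e where e: "e \<longlonglongrightarrow> d" "\<And>n i. i \<in> J \<Longrightarrow> grad (h i (x n)) (p n) \<bullet> e n = 0"
    unfolding J_def by blast
  obtain \<sigma> where \<sigma>: "\<sigma> > 0" "\<And>x y lam d. x \<in> X \<Longrightarrow> local_minimizer g h x y \<Longrightarrow> KKT_pair g h x y lam \<Longrightarrow>
      d \<in> critical_cone h x y lam \<Longrightarrow>
      d \<bullet> (hessian (\<lambda>z. lagrangian g h x z lam) y *v d) \<ge> \<sigma> * (norm d)\<^sup>2"
    using sosc unfolding uniform_SOSC_def by blast
  have "\<forall>\<^sub>F n in sequentially. \<sigma> * (norm (e n))\<^sup>2 \<le> e n \<bullet> (H n (p n) *v e n)"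
    using lam0(3)
  proof eventually_elim
    case (elim n)
    \<comment> \<open>Eventually every constraint active at \<open>p n\<close> belongs to
      \<open>J\<close>, where \<open>e n\<close> is exactly orthogonal to the gradient. Both cone
      conditions then hold whatever the sign of the multiplier.\<close>
    then have "e n \<in> critical_cone h (x n) (p n) (lam n)"
      using e(2) by (auto simp: critical_cone_def J_def)
    then show ?case unfolding H_def by (rule \<sigma>(2)[OF X(1) p kkt])
  qed
  moreover have "(\<lambda>n. \<sigma> * (norm (e n))\<^sup>2) \<longlonglongrightarrow> \<sigma> * (norm d)\<^sup>2"
    by (intro tendsto_intros e)
  ultimately have "\<sigma> * (norm d)\<^sup>2 \<le> d \<bullet> (H0 *v d)"
    using tendsto_le[OF _ tquad[OF \<open>p \<longlonglongrightarrow> p0\<close> e(1)]] by simp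
  with curv \<sigma>(1) \<open>norm d = 1\<close> show False by simp
qed

theorem theorem4p2:
  fixes X :: "(real ^ 'n) set"
    and g :: "real ^ 'n \<Rightarrow> real ^ 'm \<Rightarrow> real"
    and h :: "'k::finite \<Rightarrow> real ^ 'n \<Rightarrow> real ^ 'm \<Rightarrow> real"
  assumes "compact X"
    and "smooth_on (X \<times> UNIV) (\<lambda>(x, y). g x y)"
    and "\<And>i. smooth_on (X \<times> UNIV) (\<lambda>(x, y). h i x y)"
    and "\<And>x. x \<in> X \<Longrightarrow> feasible_set h x \<noteq> {}"
    and "uniformly_bounded h X"
    and "\<And>x. x \<in> X \<Longrightarrow> LICQ h x"
    and "\<And>x. x \<in> X \<Longrightarrow> SCSC g h x"
    and "uniform_SOSC g h X"
  shows "\<exists>c>0. \<exists>\<delta>>0. \<forall>x\<in>X. \<forall>ystar. local_minimizer g h x ystar \<longrightarrow>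
           (\<forall>y \<in> feasible_set h x \<inter> ball ystar \<delta>.
              g x y \<ge> g x ystar + c * (norm (y - ystar))\<^sup>2)"
proof (rule ccontr)
  assume neg: "\<not> ?thesis"
  \<comment> \<open>\<open>\<epsilon> n\<close> serves as both \<open>c\<close> and
    \<open>\<delta>\<close> in the negated claim.\<close>
  define \<epsilon> where "\<epsilon> n = inverse (real (Suc n))" for n
  have \<epsilon>: "\<epsilon> n > 0" for n by (simp add: \<epsilon>_def)
  have \<epsilon>lim: "\<epsilon> \<longlonglongrightarrow> 0" unfolding \<epsilon>_def[abs_def] by (rule LIMSEQ_inverse_real_of_nat)
  have "\<exists>x p y. x \<in> X \<and> local_minimizer g h x p \<and> y \<in> feasible_set h x \<inter> ball p (\<epsilon> n)
      \<and> \<not> g x y \<ge> g x p + \<epsilon> n * (norm (y - p))\<^sup>2" for n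
    using neg \<epsilon>[of n] by blast
  then obtain x p y where *: "\<And>n. x n \<in> X" "\<And>n. local_minimizer g h (x n) (p n)"
    "\<And>n. y n \<in> feasible_set h (x n)" "\<And>n. y n \<in> ball (p n) (\<epsilon> n)"
    "\<And>n. \<not> g (x n) (y n) \<ge> g (x n) (p n) + \<epsilon> n * (norm (y n - p n))\<^sup>2"
    unfolding Int_iff by metis
  \<comment> \<open>At \<open>y n = p n\<close> the growth inequality is an equality, so a point
    violating it differs from \<open>p n\<close> and has a direction.\<close>
  have ne: "y n \<noteq> p n" for n using *(5)[of n] by auto
  obtain R where R: "\<And>x y. x \<in> X \<Longrightarrow> y \<in> feasible_set h x \<Longrightarrow> norm y \<le> R"
    using assms(5) unfolding uniformly_bounded_def by blast
  \<comment> \<open>One extraction makes base points, minimizers and unit directions converge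
    together; \<open>y\<close> then follows \<open>p\<close> because their distance is below
    \<open>\<epsilon>\<close>.\<close>
  define s where "s n = (x n, p n, (y n - p n) /\<^sub>R norm (y n - p n))" for n
  have "s n \<in> X \<times> cball 0 R \<times> sphere 0 1" for n
    using *(1,2)[of n] R ne[of n] by (auto simp: s_def local_minimizer_def)
  moreover have "compact (X \<times> cball (0 :: real ^ 'm) R \<times> sphere (0 :: real ^ 'm) 1)"
    by (intro compact_Times assms(1)) auto
  ultimately obtain l r where l: "l \<in> X \<times> cball 0 R \<times> sphere 0 1" "strict_mono r" "(s \<circ> r) \<longlonglongrightarrow> l"
    unfolding compact_def by meson
  obtain x0 p0 d where l_eq: "l = (x0, p0, d)" by (cases l)
  have lim: "(\<lambda>n. x (r n)) \<longlonglongrightarrow> x0" "(\<lambda>n. p (r n)) \<longlonglongrightarrow> p0"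
    "(\<lambda>n. (y (r n) - p (r n)) /\<^sub>R norm (y (r n) - p (r n))) \<longlonglongrightarrow> d"
    using tendsto_fst[OF l(3)] tendsto_fst[OF tendsto_snd[OF l(3)]] tendsto_snd[OF tendsto_snd[OF l(3)]]
    by (simp_all add: l_eq s_def o_def)
  have \<epsilon>r: "(\<lambda>n. \<epsilon> (r n)) \<longlonglongrightarrow> 0"
    using LIMSEQ_subseq_LIMSEQ[OF \<epsilon>lim l(2)] by (simp add: o_def)
  have "norm (y (r n) - p (r n)) \<le> \<epsilon> (r n)" for n
    using *(4)[of "r n"] by (simp add: dist_norm norm_minus_commute)
  then have "(\<lambda>n. y (r n) - p (r n)) \<longlonglongrightarrow> 0"
    by (intro Lim_null_comparison[OF _ \<epsilon>r]) simp
  from tendsto_add[OF this lim(2)] have "(\<lambda>n. y (r n)) \<longlonglongrightarrow> p0" by simp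
  moreover have "x0 \<in> X" using l by (simp add: l_eq)
  ultimately have "\<exists>n. g (x (r n)) (y (r n))
      \<ge> g (x (r n)) (p (r n)) + \<epsilon> (r n) * (norm (y (r n) - p (r n)))\<^sup>2"
    by (intro quadratic_growth_sequential[where X = X and h = h and x = "\<lambda>n. x (r n)"
        and p = "\<lambda>n. p (r n)" and y = "\<lambda>n. y (r n)" and \<epsilon> = "\<lambda>n. \<epsilon> (r n)"
        and ?x0.0 = x0 and ?p0.0 = p0 and d = d] assms * ne lim \<epsilon>r)
  with *(5) show False by blast
qed

end
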